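(* Let $\mathcal{A}\subseteq\mathbb{R}^d$ be a nonempty finite set and let $f:\mathbb{R}^d\to\mathbb{R}$ be such that: (i) $-\infty<f_{\min}:=\min_{a\in\mathcal{A}}f(a)$; (ii) $f$ is differentiable and its gradient is $L_f$-Lipschitz on $\mathbb{R}^d$; (iii) for some constant $\mu\ge 0$, the function $x\mapsto f(x)+\frac{\mu}{2}\|x\|^2$ is convex. Let $\sigma(\rho):=\rho-\mu$ and let $\rho>0$ satisfy $\rho^{-1}L_f^2-\frac{\sigma(\rho)}{2}<0$. Let $(x^r,y^r,\lambda^r)_{r\ge 0}$ be generated by the ADMM-Q algorithm with parameter $\rho$, and let $(\bar x,\bar y,\bar\lambda)$ be a limit point (limit of a subsequence) of this sequence. Then $\bar x$ is a $\rho$-stationary point of the problem $\min_{x\in\mathcal{A}}f(x)$.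
   Context: Norms are Euclidean. For a nonempty finite set $\mathcal{A}$, the projection $\mathcal{P}_{\mathcal{A}}(x)$ is an element of $\arg\min_{a\in\mathcal{A}}\|x-a\|^2$; if this set has several elements, the lexicographically smallest one is chosen. Let $\mathcal{I}_{\mathcal{A}}(y)=0$ if $y\in\mathcal{A}$ and $+\infty$ otherwise. The augmented Lagrangian is $\mathcal{L}(x,y,\lambda)=f(x)+\mathcal{I}_{\mathcal{A}}(y)+\langle\lambda,x-y\rangle+\frac{\rho}{2}\|x-y\|^2$. ADMM-Q algorithm (parameter $\rho>0$): start from $x^0=y^0\in\mathcal{A}$ and arbitrary $\lambda^0\in\mathbb{R}^d$; for $r=0,1,2,\dots$ set $y^{r+1}=\mathcal{P}_{\mathcal{A}}(x^r+\rho^{-1}\lambda^r)$; $x^{r+1}=\arg\min_x\mathcal{L}(x,y^{r+1},\lambda^r)$; $\lambda^{r+1}=\lambda^r+\rho(x^{r+1}-y^{r+1})$. A point $\bar x$ is a $\rho$-stationary point of $\min_{x\in\mathcal{A}}f(x)$ if $\bar x\in\arg\min_{a\in\mathcal{A}}\|a-(\bar x-\rho^{-1}\nabla f(\bar x))\|$. *)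

theory Defs
  imports "HOL-Analysis.Analysis" "HOL-Library.Fun_Lexorder"
begin

text \<open>
  The space of dimension d is \<open>real ^ 'd\<close>, whose norm is Euclidean. The index type carries a
  linear order, which fixes the order in which coordinates are compared lexicographically.
\<close>

definition argmin_dist :: "'a::real_normed_vector set \<Rightarrow> 'a \<Rightarrow> 'a set" where
  "argmin_dist A x = {a. is_arg_min (\<lambda>a. (norm (x - a))\<^sup>2) (\<lambda>a. a \<in> A) a}"

definition proj_lex ::
  "(real ^ 'd::{finite,linorder}) set \<Rightarrow>
   real ^ 'd::{finite,linorder} \<Rightarrow> real ^ 'd::{finite,linorder}" where
  "proj_lex A x = (THE a. a \<in> argmin_dist A x \<and>
     (\<forall>b \<in> argmin_dist A x. b \<noteq> a \<longrightarrow> less_fun (vec_nth a) (vec_nth b)))"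

text \<open>The description in \<open>proj_lex\<close> is proper on nonempty finite sets.\<close>

lemma ex1_less_fun_min:
  fixes S :: "(real ^ 'd::{finite,linorder}) set"
  assumes "finite S" "S \<noteq> {}"
  shows "\<exists>!a. a \<in> S \<and> (\<forall>b \<in> S. b \<noteq> a \<longrightarrow> less_fun (vec_nth a) (vec_nth b))"
proof -
  have tri: "less_fun (vec_nth a) (vec_nth b) \<or> a = b \<or> less_fun (vec_nth b) (vec_nth a)"
    for a b :: "real ^ 'd::{finite,linorder}"
    using less_fun_trichotomy[of "vec_nth a" "vec_nth b"] by (auto simp: vec_nth_inject)
  have "\<exists>a. a \<in> S \<and> (\<forall>b \<in> S. b \<noteq> a \<longrightarrow> less_fun (vec_nth a) (vec_nth b))"
    using assms
  proof (induction S rule: finite_ne_induct)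
    case (singleton x)
    then show ?case by simp
  next
    case (insert x F)
    then obtain a where a: "a \<in> F" "\<forall>b \<in> F. b \<noteq> a \<longrightarrow> less_fun (vec_nth a) (vec_nth b)"
      by blast
    show ?case
    proof (cases "less_fun (vec_nth x) (vec_nth a)")
      case True
      then have "\<forall>b \<in> insert x F. b \<noteq> x \<longrightarrow> less_fun (vec_nth x) (vec_nth b)"
        using a by (metis insert_iff less_fun_trans)
      then show ?thesis by blast
    next
      case False
      then show ?thesis using a tri by (metis insert_iff)
    qed
  qed
  then show ?thesis using less_fun_asym by metis
qed

lemma proj_lex_in_argmin_dist:
  assumes "finite A" "A \<noteq> {}"
  shows "proj_lex A x \<in> argmin_dist A x"
proof -
  have "finite (argmin_dist A x)"
    using assms(1) by (rule rev_finite_subset) (auto simp: argmin_dist_def is_arg_min_def)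
  moreover have "argmin_dist A x \<noteq> {}"
    using ex_is_arg_min_if_finite[OF assms, of "\<lambda>a. (norm (x - a))\<^sup>2"]
    by (auto simp: argmin_dist_def)
  ultimately show ?thesis
    unfolding proj_lex_def using theI'[OF ex1_less_fun_min] by blast
qed

definition indicator_penalty :: "'a set \<Rightarrow> 'a \<Rightarrow> ereal" where
  "indicator_penalty A y = (if y \<in> A then 0 else \<infinity>)"

definition aug_lagrangian ::
  "('a::real_inner \<Rightarrow> real) \<Rightarrow> 'a set \<Rightarrow> real \<Rightarrow> 'a \<Rightarrow> 'a \<Rightarrow> 'a \<Rightarrow> ereal" where
  "aug_lagrangian f A \<rho> x y l =
     ereal (f x) + indicator_penalty A y + ereal (l \<bullet> (x - y)) + ereal (\<rho> / 2 * (norm (x - y))\<^sup>2)"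

text \<open>
  The update of \<open>x\<close> only requires a minimizer: if \<open>f\<close> plus \<open>\<mu> / 2\<close> times the squared norm is convex
  and \<open>\<rho> > \<mu>\<close>, then the augmented Lagrangian is strongly convex in \<open>x\<close> and the minimizer is unique.
\<close>

definition admm_q ::
  "(real ^ 'd::{finite,linorder} \<Rightarrow> real) \<Rightarrow>
   (real ^ 'd::{finite,linorder}) set \<Rightarrow> real \<Rightarrow>
   (nat \<Rightarrow> real ^ 'd::{finite,linorder}) \<Rightarrow>
   (nat \<Rightarrow> real ^ 'd::{finite,linorder}) \<Rightarrow>
   (nat \<Rightarrow> real ^ 'd::{finite,linorder}) \<Rightarrow> bool" where
  "admm_q f A \<rho> x y l \<longleftrightarrow>
     x 0 = y 0 \<and> y 0 \<in> A \<and>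
     (\<forall>r. y (Suc r) = proj_lex A (x r + inverse \<rho> *\<^sub>R l r) \<and>
          is_arg_min (\<lambda>u. aug_lagrangian f A \<rho> u (y (Suc r)) (l r)) (\<lambda>u. True) (x (Suc r)) \<and>
          l (Suc r) = l r + \<rho> *\<^sub>R (x (Suc r) - y (Suc r)))"

definition gradient :: "('a::real_inner \<Rightarrow> real) \<Rightarrow> 'a \<Rightarrow> 'a" where
  "gradient f x = (THE g. GDERIV f x :> g)"

definition rho_stationary ::
  "('a::real_inner \<Rightarrow> real) \<Rightarrow> 'a set \<Rightarrow> real \<Rightarrow> 'a \<Rightarrow> bool" where
  "rho_stationary f A \<rho> z \<longleftrightarrow>
     is_arg_min (\<lambda>a. norm (a - (z - inverse \<rho> *\<^sub>R gradient f z))) (\<lambda>a. a \<in> A) z"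

end

theory Submission
  imports Defs
begin

text \<open>
  Optimality of the update of \<open>x\<close> gives \<open>l = - \<nabla>f(x)\<close> after every step. Along the iteration the
  augmented Lagrangian does not increase in the \<open>y\<close>-update, drops by \<open>\<sigma>/2 * |\<Delta>x|^2\<close> in the
  \<open>x\<close>-update (strong convexity) and grows by \<open>|\<Delta>l|^2/\<rho> \<le> L^2/\<rho> * |\<Delta>x|^2\<close> in the \<open>l\<close>-update
  (Lipschitz gradient), so it decreases by a positive multiple of \<open>|\<Delta>x|^2\<close>. Being continuous, it
  converges along the given subsequence, hence along the whole sequence, so that \<open>\<Delta>x\<close>, \<open>\<Delta>l\<close> and
  \<open>x - y\<close> tend to 0. Passing to the limit in the projection inequality yields stationarity.
\<close>

text \<open>\<open>gradient\<close> is a definite description, so existence and uniqueness are both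
  due: the Riesz vector of a derivative \<open>D\<close> is \<open>adjoint D 1\<close>, and
  derivatives are unique.\<close>

lemma GDERIV_gradient:
  fixes f :: "'a::euclidean_space \<Rightarrow> real"
  assumes "f differentiable (at u)"
  shows "GDERIV f u :> gradient f u"
proof -
  obtain D where D: "(f has_derivative D) (at u)"
    using assms by (auto simp: differentiable_def)
  have "D = (\<lambda>h. h \<bullet> adjoint D 1)"
    using adjoint_works[OF has_derivative_linear[OF D], of _ 1] by (auto simp: fun_eq_iff)
  then have ex: "GDERIV f u :> adjoint D 1"
    using D by (simp add: gderiv_def)
  have "g = adjoint D 1" if "GDERIV f u :> g" for g
  proof -
    have "(\<lambda>h. h \<bullet> g) = (\<lambda>h. h \<bullet> adjoint D 1)"
      using that ex has_derivative_unique unfolding gderiv_def by blast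
    then show ?thesis
      by (metis vector_eq_ldot)
  qed
  then show ?thesis
    unfolding gradient_def using ex by (rule theI[rotated])
qed

lemma GDERIV_min_zero:
  assumes "GDERIV g z :> G" and "\<And>u. g z \<le> g u"
  shows "G = 0"
proof -
  have "(\<lambda>h. h \<bullet> G) = (\<lambda>h. 0)"
    using assms by (intro has_derivative_local_min[of g _ z]) (auto simp: gderiv_def)
  then show ?thesis
    by (metis inner_eq_zero_iff)
qed

text \<open>Compare \<open>z\<close> with a point at parameter \<open>t\<close> on the segment to
  \<open>u\<close>: convexity bounds the value there, minimality bounds it below by
  \<open>g z\<close>. Dividing by \<open>t\<close> and letting \<open>t\<close> tend to 0 leaves the
  full quadratic term.\<close>

lemma minimizer_quadratic_growth:
  fixes g :: "'a::real_inner \<Rightarrow> real"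
  assumes conv: "convex_on UNIV (\<lambda>u. g u - c / 2 * (norm u)\<^sup>2)"
    and min: "\<And>u. g z \<le> g u"
  shows "g z + c / 2 * (norm (u - z))\<^sup>2 \<le> g u"
proof -
  have bound: "c / 2 * (norm (u - z))\<^sup>2 * (1 - t) \<le> g u - g z" if t: "0 < t" "t < 1" for t
  proof -
    define v where "v = (1 - t) *\<^sub>R z + t *\<^sub>R u"
    have "g v - c / 2 * (norm v)\<^sup>2
        \<le> (1 - t) * (g z - c / 2 * (norm z)\<^sup>2) + t * (g u - c / 2 * (norm u)\<^sup>2)"
      unfolding v_def using t by (intro convex_onD[OF conv]) auto
    moreover have norm_v: "(norm v)\<^sup>2
        = (1 - t) * (norm z)\<^sup>2 + t * (norm u)\<^sup>2 - t * (1 - t) * (norm (u - z))\<^sup>2"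
      unfolding v_def power2_norm_eq_inner
      by (simp add: inner_left_distrib inner_right_distrib inner_diff_left inner_diff_right
          inner_commute algebra_simps)
    ultimately have "g v \<le> (1 - t) * g z + t * g u - c / 2 * (t * (1 - t) * (norm (u - z))\<^sup>2)"
      unfolding norm_v by (simp add: field_simps)
    with min[of v] have "t * (c / 2 * (norm (u - z))\<^sup>2 * (1 - t)) \<le> t * (g u - g z)"
      by (simp add: algebra_simps diff_divide_distrib)
    then show ?thesis
      using t by (simp del: times_divide_eq_left)
  qed
  have "((\<lambda>t. c / 2 * (norm (u - z))\<^sup>2 * (1 - t)) \<longlongrightarrow> c / 2 * (norm (u - z))\<^sup>2 * (1 - 0))
      (at_right 0)"
    by (intro tendsto_intros)
  moreover have "\<forall>\<^sub>F t in at_right 0. c / 2 * (norm (u - z))\<^sup>2 * (1 - t) \<le> g u - g z"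
    using eventually_at_right_real[OF zero_less_one] by eventually_elim (rule bound, auto)
  ultimately have "c / 2 * (norm (u - z))\<^sup>2 * (1 - 0) \<le> g u - g z"
    by (rule tendsto_upperbound) simp
  then show ?thesis by simp
qed

lemma convex_on_add_affine:
  fixes h :: "'a::real_inner \<Rightarrow> real"
  assumes "convex_on UNIV h"
  shows "convex_on UNIV (\<lambda>u. h u + (p \<bullet> u + b))"
proof (rule convex_on_add[OF assms])
  show "convex_on UNIV (\<lambda>u. p \<bullet> u + b)"
    by (rule convex_onI) (simp_all add: inner_right_distrib algebra_simps)
qed

text \<open>Since \<open>n \<le> s n\<close>, the limit \<open>c\<close> of the subsequence bounds
  all of \<open>X\<close> from below; monotone convergence then applies, and both limits
  agree.\<close>

lemma decseq_subseq_convergent: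
  fixes X :: "nat \<Rightarrow> real"
  assumes "decseq X" and "strict_mono s" and "(X \<circ> s) \<longlonglongrightarrow> c"
  shows "X \<longlonglongrightarrow> c"
proof -
  have "decseq (X \<circ> s)"
    using assms(1,2) by (auto simp: decseq_def strict_mono_less_eq)
  then have lower: "c \<le> X n" for n
    using decseq_ge[OF _ assms(3)] decseqD[OF assms(1) seq_suble[OF assms(2)], of n]
    by (metis comp_apply order_trans)
  then obtain d where d: "X \<longlonglongrightarrow> d"
    using decseq_convergent[OF assms(1)] by blast
  then have "(X \<circ> s) \<longlonglongrightarrow> d"
    using assms(2) by (rule LIMSEQ_subseq_LIMSEQ)
  then show ?thesis
    using d assms(3) LIMSEQ_unique by blast
qed

text \<open>The real-valued part of \<open>aug_lagrangian\<close>. Every \<open>y\<close>-iterate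
  lies in \<open>A\<close>, so the estimates and limits can avoid \<open>ereal\<close>.\<close>

definition lagr :: "('a::real_inner \<Rightarrow> real) \<Rightarrow> real \<Rightarrow> 'a \<Rightarrow> 'a \<Rightarrow> 'a \<Rightarrow> real" where
  "lagr f \<rho> x y l = f x + l \<bullet> (x - y) + \<rho> / 2 * (norm (x - y))\<^sup>2"

lemma aug_lagrangian_eq_lagr:
  "y \<in> A \<Longrightarrow> aug_lagrangian f A \<rho> x y l = ereal (lagr f \<rho> x y l)"
  by (simp add: aug_lagrangian_def lagr_def indicator_penalty_def)

text \<open>In this form \<open>y\<close> enters only through its distance to
  \<open>x + inverse \<rho> *\<^sub>R l\<close>, so the projection step minimizes
  \<open>lagr\<close> over \<open>A\<close>.\<close>

lemma lagr_complete_square: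
  assumes "\<rho> > 0"
  shows "lagr f \<rho> x y l
    = f x + \<rho> / 2 * (norm (x + inverse \<rho> *\<^sub>R l - y))\<^sup>2 - (norm l)\<^sup>2 / (2 * \<rho>)"
proof -
  have "(norm (x + inverse \<rho> *\<^sub>R l - y))\<^sup>2 = (norm ((x - y) + inverse \<rho> *\<^sub>R l))\<^sup>2"
    by (simp add: algebra_simps)
  also have "\<dots> = (norm (x - y))\<^sup>2 + 2 * inverse \<rho> * (l \<bullet> (x - y)) + (inverse \<rho>)\<^sup>2 * (norm l)\<^sup>2"
    unfolding power2_norm_eq_inner
    by (simp only: inner_left_distrib inner_right_distrib inner_scaleR_left inner_scaleR_right
        inner_commute[of "x - y" l] power2_eq_square) (simp add: algebra_simps)
  finally show ?thesis
    using assms by (simp add: lagr_def field_simps power2_eq_square)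
qed

lemma argmin_dist_memD:
  assumes "a \<in> argmin_dist A x"
  shows "a \<in> A" and "b \<in> A \<Longrightarrow> norm (x - a) \<le> norm (x - b)"
proof -
  show "a \<in> A"
    using assms by (simp add: argmin_dist_def is_arg_min_def)
  show "norm (x - a) \<le> norm (x - b)" if "b \<in> A"
    using assms that by (auto simp: argmin_dist_def is_arg_min_def not_less intro: power2_le_imp_le)
qed

text \<open>Subtracting \<open>(\<rho> - \<mu>) / 2 * (norm u)\<^sup>2\<close> from the Lagrangian
  leaves the convex function of \<open>conv\<close> plus an affine function of
  \<open>u\<close>.\<close>

lemma lagr_x_minimizer_growth:
  assumes conv: "convex_on UNIV (\<lambda>u. f u + \<mu> / 2 * (norm u)\<^sup>2)"
    and min: "\<And>u. lagr f \<rho> z y l \<le> lagr f \<rho> u y l"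
  shows "lagr f \<rho> z y l + (\<rho> - \<mu>) / 2 * (norm (u - z))\<^sup>2 \<le> lagr f \<rho> u y l"
proof (rule minimizer_quadratic_growth[where g = "\<lambda>u. lagr f \<rho> u y l"])
  have eq: "lagr f \<rho> u y l - (\<rho> - \<mu>) / 2 * (norm u)\<^sup>2
      = f u + \<mu> / 2 * (norm u)\<^sup>2 + ((l - \<rho> *\<^sub>R y) \<bullet> u + (\<rho> / 2 * (norm y)\<^sup>2 - l \<bullet> y))" for u
    unfolding lagr_def power2_norm_eq_inner
    by (simp add: inner_left_distrib inner_right_distrib inner_diff_left inner_diff_right
        inner_commute field_simps)
  show "convex_on UNIV (\<lambda>u. lagr f \<rho> u y l - (\<rho> - \<mu>) / 2 * (norm u)\<^sup>2)"
    unfolding eq by (rule convex_on_add_affine[OF conv])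
qed (rule min)

text \<open>The first-order condition in \<open>x\<close>, arranged so that the left side is exactly
  the updated multiplier.\<close>

lemma lagr_x_minimizer_gradient:
  fixes f :: "'a::euclidean_space \<Rightarrow> real"
  assumes diff: "f differentiable (at z)"
    and min: "\<And>u. lagr f \<rho> z y l \<le> lagr f \<rho> u y l"
  shows "l + \<rho> *\<^sub>R (z - y) = - gradient f z"
proof -
  have "(f has_derivative (\<lambda>h. h \<bullet> gradient f z)) (at z)"
    using GDERIV_gradient[OF diff] by (simp add: gderiv_def)
  then have "((\<lambda>u. f u + l \<bullet> (u - y) + \<rho> / 2 * ((u - y) \<bullet> (u - y))) has_derivative
      (\<lambda>h. h \<bullet> (gradient f z + l + \<rho> *\<^sub>R (z - y)))) (at z)"
    by (auto intro!: derivative_eq_intros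
        simp: inner_right_distrib inner_commute algebra_simps)
  then have "GDERIV (\<lambda>u. lagr f \<rho> u y l) z :> gradient f z + l + \<rho> *\<^sub>R (z - y)"
    by (simp add: gderiv_def lagr_def power2_norm_eq_inner)
  from GDERIV_min_zero[OF this min] show ?thesis
    by (simp add: eq_neg_iff_add_eq_0 algebra_simps)
qed

theorem theorem3p9:
  fixes A :: "(real ^ 'd::{finite,linorder}) set"
    and f :: "real ^ 'd::{finite,linorder} \<Rightarrow> real"
    and L\<^sub>f \<mu> \<rho> :: real
    and \<sigma> :: "real \<Rightarrow> real"
    and x y l :: "nat \<Rightarrow> real ^ 'd::{finite,linorder}"
    and xbar ybar lbar :: "real ^ 'd::{finite,linorder}"
    and s :: "nat \<Rightarrow> nat"
  assumes "finite A" and "A \<noteq> {}"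
    and "- \<infinity> < (MIN a\<in>A. ereal (f a))"
    and "\<And>u. f differentiable (at u)"
    and "L\<^sub>f-lipschitz_on UNIV (gradient f)"
    and "\<mu> \<ge> 0"
    and "convex_on UNIV (\<lambda>u. f u + \<mu> / 2 * (norm u)\<^sup>2)"
    and "\<And>t. \<sigma> t = t - \<mu>"
    and "\<rho> > 0"
    and "inverse \<rho> * L\<^sub>f\<^sup>2 - \<sigma> \<rho> / 2 < 0"
    and "admm_q f A \<rho> x y l"
    and "strict_mono s"
    and "(\<lambda>k. (x (s k), y (s k), l (s k))) \<longlonglongrightarrow> (xbar, ybar, lbar)"
  shows "rho_stationary f A \<rho> xbar"
proof -
  note fin = assms(1) and ne = assms(2) and diff = assms(4) and lip = assms(5)
    and conv = assms(7) and rho = assms(9) and admm = assms(11) and s = assms(12) and lim = assms(13)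
  \<comment> \<open>The gain of the \<open>x\<close>-update minus the loss of the multiplier update,
    both per squared step of \<open>x\<close>; the condition on \<open>\<rho>\<close> makes it
    positive.\<close>
  define c where "c = (\<rho> - \<mu>) / 2 - inverse \<rho> * L\<^sub>f\<^sup>2"
  define V where "V r = lagr f \<rho> (x r) (y r) (l r)" for r
  have c: "c > 0"
    using assms(8,10) by (simp add: c_def)
  have y_proj: "y (Suc r) \<in> argmin_dist A (x r + inverse \<rho> *\<^sub>R l r)" for r
    using admm proj_lex_in_argmin_dist[OF fin ne] by (simp add: admm_q_def)
  have yA: "y r \<in> A" for r
    using admm argmin_dist_memD(1)[OF y_proj] by (cases r) (auto simp: admm_q_def)
  have x_min: "lagr f \<rho> (x (Suc r)) (y (Suc r)) (l r) \<le> lagr f \<rho> u (y (Suc r)) (l r)" for r u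
  proof -
    have "is_arg_min (\<lambda>u. aug_lagrangian f A \<rho> u (y (Suc r)) (l r)) (\<lambda>u. True) (x (Suc r))"
      using admm unfolding admm_q_def by blast
    then show ?thesis
      using yA by (simp add: is_arg_min_def aug_lagrangian_eq_lagr not_less)
  qed
  have l_step: "l (Suc r) = l r + \<rho> *\<^sub>R (x (Suc r) - y (Suc r))" for r
    using admm by (simp add: admm_q_def)
  have l_grad: "l (Suc r) = - gradient f (x (Suc r))" for r
    using lagr_x_minimizer_gradient[OF diff x_min] by (simp add: l_step)
  \<comment> \<open>Both multipliers must be negative gradients, which \<open>l_grad\<close> gives
    from index 1 on.\<close>
  have l_lip: "norm (l (Suc (Suc r)) - l (Suc r)) \<le> L\<^sub>f * norm (x (Suc (Suc r)) - x (Suc r))" for r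
    using lipschitz_onD[OF lip, of "x (Suc r)" "x (Suc (Suc r))"]
    by (simp add: l_grad dist_norm norm_minus_commute)

  have descent: "V (Suc (Suc r)) + c * (norm (x (Suc (Suc r)) - x (Suc r)))\<^sup>2 \<le> V (Suc r)" for r
  proof -
    let ?q = "Suc r" and ?r = "Suc (Suc r)"
    let ?d = "(norm (x ?r - x ?q))\<^sup>2"
    have "(norm (x ?q + inverse \<rho> *\<^sub>R l ?q - y ?r))\<^sup>2 \<le> (norm (x ?q + inverse \<rho> *\<^sub>R l ?q - y ?q))\<^sup>2"
      by (rule power_mono[OF argmin_dist_memD(2)[OF y_proj yA]]) simp
    then have "lagr f \<rho> (x ?q) (y ?r) (l ?q) \<le> V ?q"
      using rho by (simp add: V_def lagr_complete_square)
    moreover have "lagr f \<rho> (x ?r) (y ?r) (l ?q) + (\<rho> - \<mu>) / 2 * ?d \<le> lagr f \<rho> (x ?q) (y ?r) (l ?q)"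
      using lagr_x_minimizer_growth[OF conv x_min, of ?q "x ?q"] by (simp add: norm_minus_commute)
    \<comment> \<open>Only the multiplier changes here, and \<open>x ?r - y ?r\<close> is the
      multiplier increment divided by \<open>\<rho>\<close>.\<close>
    moreover have "V ?r = lagr f \<rho> (x ?r) (y ?r) (l ?q) + inverse \<rho> * (norm (l ?r - l ?q))\<^sup>2"
      using rho by (simp add: V_def lagr_def l_step[of ?q] inner_left_distrib dot_square_norm
          power_mult_distrib power2_eq_square[of \<rho>])
    moreover have "inverse \<rho> * (norm (l ?r - l ?q))\<^sup>2 \<le> inverse \<rho> * (L\<^sub>f\<^sup>2 * ?d)"
      using power_mono[OF l_lip[of r], of 2] rho by (simp add: power_mult_distrib)
    ultimately show ?thesis
      by (simp add: c_def algebra_simps)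
  qed

  have xs: "(x \<circ> s) \<longlonglongrightarrow> xbar" and ys: "(y \<circ> s) \<longlonglongrightarrow> ybar" and ls: "(l \<circ> s) \<longlonglongrightarrow> lbar"
    using tendsto_fst[OF lim] tendsto_fst[OF tendsto_snd[OF lim]] tendsto_snd[OF tendsto_snd[OF lim]]
    by (simp_all add: comp_def)
  have grad_cont: "isCont (gradient f) u" for u
    using lipschitz_on_continuous_on[OF lip] by (simp add: continuous_on_eq_continuous_at)

  have Vs: "(V \<circ> s) \<longlonglongrightarrow> lagr f \<rho> xbar ybar lbar"
    using isCont_tendsto_compose[OF differentiable_imp_continuous_within[OF diff] xs] xs ys ls
    unfolding V_def lagr_def comp_def by (intro tendsto_intros)
  \<comment> \<open>Descent starts at index 1 because \<open>l 0\<close> is arbitrary, hence the shift.\<close>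
  have s_pos: "s (Suc k) > 0" for k
    using seq_suble[OF s, of "Suc k"] by linarith
  have Vlim: "(\<lambda>n. V (Suc n)) \<longlonglongrightarrow> lagr f \<rho> xbar ybar lbar"
  proof (rule decseq_subseq_convergent)
    show "decseq (\<lambda>n. V (Suc n))"
    proof (rule decseq_SucI)
      show "V (Suc (Suc n)) \<le> V (Suc n)" for n
        by (rule order_trans[OF _ descent]) (use c in simp)
    qed
    \<comment> \<open>Since \<open>s 0\<close> may be 0, the first term of the subsequence is
      dropped; \<open>s_pos\<close> then keeps the subtraction on naturals from truncating.\<close>
    show "strict_mono (\<lambda>k. s (Suc k) - 1)"
    proof (rule strict_monoI_Suc)
      show "s (Suc k) - 1 < s (Suc (Suc k)) - 1" for k
        using strict_monoD[OF s, of "Suc k" "Suc (Suc k)"] s_pos[of k] by linarith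
    qed
    have "((\<lambda>n. V (Suc n)) \<circ> (\<lambda>k. s (Suc k) - 1)) = (\<lambda>k. (V \<circ> s) (Suc k))"
      using s_pos by (simp add: fun_eq_iff)
    then show "((\<lambda>n. V (Suc n)) \<circ> (\<lambda>k. s (Suc k) - 1)) \<longlonglongrightarrow> lagr f \<rho> xbar ybar lbar"
      using LIMSEQ_Suc[OF Vs] by simp
  qed
  \<comment> \<open>Consecutive values share one limit, so the decrease vanishes and, by
    \<open>descent\<close>, squeezes the squared step of \<open>x\<close>.\<close>
  have V_drop: "(\<lambda>n. (V (Suc n) - V (Suc (Suc n))) / c) \<longlonglongrightarrow> 0"
    using tendsto_diff[OF Vlim LIMSEQ_Suc[OF Vlim]] by (intro tendsto_divide_zero) simp
  have "(\<lambda>n. (norm (x (Suc (Suc n)) - x (Suc n)))\<^sup>2) \<longlonglongrightarrow> 0"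
  proof (rule tendsto_sandwich[OF _ _ tendsto_const V_drop])
    show "\<forall>\<^sub>F n in sequentially. (norm (x (Suc (Suc n)) - x (Suc n)))\<^sup>2
        \<le> (V (Suc n) - V (Suc (Suc n))) / c"
    proof (rule always_eventually, rule allI)
      show "(norm (x (Suc (Suc n)) - x (Suc n)))\<^sup>2 \<le> (V (Suc n) - V (Suc (Suc n))) / c" for n
        using descent[of n] c by (simp add: pos_le_divide_eq mult.commute)
    qed
  qed simp
  then have "(\<lambda>n. sqrt ((norm (x (Suc (Suc n)) - x (Suc n)))\<^sup>2)) \<longlonglongrightarrow> sqrt 0"
    by (rule tendsto_real_sqrt)
  then have dx_norm: "(\<lambda>n. norm (x (Suc (Suc n)) - x (Suc n))) \<longlonglongrightarrow> 0"
    by simp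
  have "(\<lambda>n. l (Suc (Suc n)) - l (Suc n)) \<longlonglongrightarrow> 0"
    by (rule Lim_null_comparison[OF _ tendsto_mult_right_zero[OF dx_norm, of L\<^sub>f]]) (use l_lip in auto)
  \<comment> \<open>A limit ignores the first term, so the shift forced by the arbitrary
    \<open>l 0\<close> is undone.\<close>
  then have dl: "(\<lambda>n. l (Suc n) - l n) \<longlonglongrightarrow> 0"
    by (rule LIMSEQ_imp_Suc[of "\<lambda>n. l (Suc n) - l n"])
  have dx: "(\<lambda>n. x (Suc n) - x n) \<longlonglongrightarrow> 0"
    using dx_norm by (intro LIMSEQ_imp_Suc[of "\<lambda>n. x (Suc n) - x n"]) (simp add: tendsto_norm_zero_iff)

  have dxs: "(\<lambda>k. x (Suc (s k)) - x (s k)) \<longlonglongrightarrow> 0" and dls: "(\<lambda>k. l (Suc (s k)) - l (s k)) \<longlonglongrightarrow> 0"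
    using LIMSEQ_subseq_LIMSEQ[OF dx s] LIMSEQ_subseq_LIMSEQ[OF dl s] by (simp_all add: comp_def)
  have xs': "(\<lambda>k. x (Suc (s k))) \<longlonglongrightarrow> xbar" and ls': "(\<lambda>k. l (Suc (s k))) \<longlonglongrightarrow> lbar"
    using tendsto_add[OF dxs xs] tendsto_add[OF dls ls] by (simp_all add: comp_def)
  \<comment> \<open>The multiplier update solved for \<open>y (Suc r)\<close>: the new
    \<open>y\<close> inherits the limit of the new \<open>x\<close>.\<close>
  have "(\<lambda>k. x (Suc (s k)) - inverse \<rho> *\<^sub>R (l (Suc (s k)) - l (s k))) \<longlonglongrightarrow> xbar - inverse \<rho> *\<^sub>R 0"
    by (intro tendsto_intros xs' dls)
  moreover have "x (Suc r) - inverse \<rho> *\<^sub>R (l (Suc r) - l r) = y (Suc r)" for r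
    using rho by (simp add: l_step)
  ultimately have ys': "(\<lambda>k. y (Suc (s k))) \<longlonglongrightarrow> xbar"
    by simp
  have "(\<lambda>k. l (Suc (s k))) \<longlonglongrightarrow> - gradient f xbar"
    unfolding l_grad by (intro tendsto_minus isCont_tendsto_compose[OF grad_cont] xs')
  then have lbar: "lbar = - gradient f xbar"
    using ls' LIMSEQ_unique by blast
  have "xbar \<in> A"
    using closed_sequentially[OF finite_imp_closed[OF fin] _ ys'] yA by blast
  moreover have "norm (xbar - (xbar - inverse \<rho> *\<^sub>R gradient f xbar))
      \<le> norm (a - (xbar - inverse \<rho> *\<^sub>R gradient f xbar))" if "a \<in> A" for a
  proof -
    \<comment> \<open>The projection inequality mixes the indices \<open>s k\<close> and
      \<open>Suc (s k)\<close>, harmless because steps vanish. With \<open>lbar\<close> the negative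
      gradient, the projected point becomes the gradient step from \<open>xbar\<close>.\<close>
    have "norm (xbar + inverse \<rho> *\<^sub>R lbar - xbar) \<le> norm (xbar + inverse \<rho> *\<^sub>R lbar - a)"
    proof (rule LIMSEQ_le)
      show "(\<lambda>k. norm (x (s k) + inverse \<rho> *\<^sub>R l (s k) - y (Suc (s k))))
          \<longlonglongrightarrow> norm (xbar + inverse \<rho> *\<^sub>R lbar - xbar)"
        using xs ls ys' unfolding comp_def by (intro tendsto_intros)
      show "(\<lambda>k. norm (x (s k) + inverse \<rho> *\<^sub>R l (s k) - a))
          \<longlonglongrightarrow> norm (xbar + inverse \<rho> *\<^sub>R lbar - a)"
        using xs ls unfolding comp_def by (intro tendsto_intros)
    qed (use argmin_dist_memD(2)[OF y_proj that] in blast)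
    then show ?thesis
      by (simp add: lbar norm_minus_commute)
  qed
  ultimately show ?thesis
    by (auto simp: rho_stationary_def is_arg_min_def not_less)
qed

end
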